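(* Let $m,m_0\in\mathbb{N}$ with $m_0<m$. Let $\mathcal{J}:\mathbb{R}^m\to\mathbb{R}\cup\{+\infty\}$ be finite, convex and continuously differentiable on a neighbourhood of $[0,1]^m$. Let $$K:=\Big\{w\in\mathbb{R}^m \;\Big|\; 0\le w_k\le 1 \text{ for all } k\le m,\ \sum_{k=1}^m w_k\le m_0\Big\},$$ and assume that there are at least $m_0$ indices $k\in\{1,\dots,m\}$ for which $\nabla\mathcal{J}(w)_k<0$ for all $w\in K$. Fix any $w^*\in K$ and assume (reordering the indices if necessary) that $$\nabla\mathcal{J}(w^* )_1\le\nabla\mathcal{J}(w^* )_2\le\dots\le\nabla\mathcal{J}(w^* )_m .$$ 1. Suppose $\nabla\mathcal{J}(w^* )_{m_0}<\nabla\mathcal{J}(w^* )_{m_0+1}$. Then $w^*$ is a global minimum of $\mathcal{J}$ over $K$ if and only if both of the following hold: (a) $w^*_k=1$ for all $k\le m_0$ (all $k\le m_0$ are dominant); (b) $w^*_k=0$ for all $k>m_0$ (all $k>m_0$ are redundant). 2. Suppose $\nabla\mathcal{J}(w^* )_{m_0}=\nabla\mathcal{J}(w^* )_{m_0+1}$. Define $$\underline{m_0}:=\max\{k\in\{1,\dots,m\} \mid \nabla\mathcal{J}(w^* )_k<\nabla\mathcal{J}(w^* )_{m_0}\},\qquad \overline{m_0}:=\min\{k\in\{1,\dots,m\}\mid \nabla\mathcal{J}(w^* )_{m_0}<\nabla\mathcal{J}(w^* )_k\},$$ with the convention $\underline{m_0}=0$, respectively $\overline{m_0}=m+1$, if the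 respective set is empty. Then $w^*$ is a global minimum of $\mathcal{J}$ over $K$ if and only if all of the following hold: (a) $w^*_k=1$ for all $k\le\underline{m_0}$ (all $k\le \underline{m_0}$ are dominant); (b) $w^*_k=0$ for all $k\ge\overline{m_0}$ (all $k\ge\overline{m_0}$ are redundant); (c) $\sum_{k=1}^m w^*_k=m_0$; in particular, $w^*\in\partial K$.
   Context: For a vector $w\in\mathbb{R}^m$, $w_k$ denotes its $k$-th component, and $\nabla\mathcal{J}(w)_k$ is the $k$-th component of the gradient. Given a global minimum $w^*$ of $\mathcal{J}$ over $K$, an index $k$ is called dominant if $w^*_k=1$, redundant if $w^*_k=0$, and free otherwise. $\partial K$ denotes the topological boundary of $K$ in $\mathbb{R}^m$. *)

theory Defs
  imports "HOL-Analysis.Analysis" "HOL-Library.Extended_Real"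
begin

definition grad :: "('a::real_inner \<Rightarrow> real) \<Rightarrow> 'a \<Rightarrow> 'a" where
  "grad f x = (THE D. GDERIV f x :> D)"

text \<open>Only meaningful for open sets \<open>U\<close>, since derivatives are taken in the full space.\<close>

definition cont_diff_on :: "('a::real_inner \<Rightarrow> real) \<Rightarrow> 'a set \<Rightarrow> bool" where
  "cont_diff_on f U \<longleftrightarrow> (\<forall>x\<in>U. f differentiable (at x)) \<and> continuous_on U (grad f)"

text \<open>
  Finite, convex and continuously differentiable on some neighbourhood of \<open>S\<close>. The library's
  \<open>convex_on U f\<close> includes convexity of \<open>U\<close>; for compact convex \<open>S\<close> this is no restriction,
  because every neighbourhood of \<open>S\<close> then contains an open convex one.
\<close>

definition finite_convex_C1_near :: "('a::real_inner \<Rightarrow> ereal) \<Rightarrow> 'a set \<Rightarrow> bool" where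
  "finite_convex_C1_near J S \<longleftrightarrow>
     (\<exists>U. open U \<and> S \<subseteq> U \<and> (\<forall>w\<in>U. \<bar>J w\<bar> \<noteq> \<infinity>) \<and>
          convex_on U (\<lambda>w. real_of_ereal (J w)) \<and>
          cont_diff_on (\<lambda>w. real_of_ereal (J w)) U)"

text \<open>The gradient of an extended-real-valued function, to be used where it is locally finite.\<close>

definition egrad :: "('a::real_inner \<Rightarrow> ereal) \<Rightarrow> 'a \<Rightarrow> 'a" where
  "egrad J = grad (\<lambda>w. real_of_ereal (J w))"

definition feasible :: "nat \<Rightarrow> (real ^ 'm) set" where
  "feasible m0 = {w. (\<forall>k. 0 \<le> w $ k \<and> w $ k \<le> 1) \<and> (\<Sum>k\<in>UNIV. w $ k) \<le> real m0}"

definition lower_index :: "nat \<Rightarrow> (nat \<Rightarrow> real) \<Rightarrow> nat \<Rightarrow> nat" where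
  "lower_index m g m0 =
     (let S = {k \<in> {1..m}. g k < g m0} in if S = {} then 0 else Max S)"

definition upper_index :: "nat \<Rightarrow> (nat \<Rightarrow> real) \<Rightarrow> nat \<Rightarrow> nat" where
  "upper_index m g m0 =
     (let S = {k \<in> {1..m}. g m0 < g k} in if S = {} then m + 1 else Min S)"

end

theory Submission
  imports Defs
begin

text \<open>
  Convexity makes minimality of \<open>w\<close> over the convex set \<open>K\<close> equivalent to the variational
  inequality \<open>0 \<le> c \<bullet> (v - w)\<close> for all \<open>v \<in> K\<close>, where \<open>c\<close> is the gradient at \<open>w\<close>
  (\<open>minimum_iff_variational_inequality\<close>). So \<open>w\<close> has to solve the linear program of minimising
  \<open>c \<bullet> v\<close> over \<open>K\<close>.

  Let \<open>\<theta>\<close> be the \<open>m\<^sub>0\<close>-th smallest entry of \<open>c\<close>. It is negative, because at least \<open>m\<^sub>0\<close> entries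
  are. It serves as the Lagrange multiplier of the budget \<open>\<Sum>k. v\<^sub>k \<le> m\<^sub>0\<close>:
  \<open>c \<bullet> (v - w) = (\<Sum>k. (c\<^sub>k - \<theta>) * (v\<^sub>k - w\<^sub>k)) + \<theta> * ((\<Sum>k. v\<^sub>k) - (\<Sum>k. w\<^sub>k))\<close>.
  If \<open>w\<close> spends the whole budget, equals \<open>1\<close> where \<open>c\<^sub>k < \<theta>\<close> and equals \<open>0\<close> where \<open>\<theta> < c\<^sub>k\<close>,
  then no term on the right is negative. Conversely, if \<open>v\<close> is the indicator of \<open>m\<^sub>0\<close> indices
  with smallest entries, then no term is positive; since an optimal \<open>w\<close> makes the left-hand side
  nonnegative, all terms vanish, and this is the same list of conditions on \<open>w\<close>
  (\<open>linear_program_optimal_iff\<close>).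

  This one characterisation (\<open>minimum_iff_threshold\<close>) gives both parts of the theorem. In the
  second part it is the stated condition, read through the sorted enumeration. In the first part
  the gap after position \<open>m\<^sub>0\<close> forces \<open>w\<close> to vanish beyond \<open>m\<^sub>0\<close>, and the budget \<open>m\<^sub>0\<close> can then
  only be spent by the value \<open>1\<close> at each of the first \<open>m\<^sub>0\<close> indices.
\<close>

section \<open>Minimality and the gradient\<close>

lemma GDERIV_unique:
  assumes "GDERIV f x :> D" and "GDERIV f x :> E"
  shows "D = E"
proof -
  have "(\<lambda>h. h \<bullet> D) = (\<lambda>h. h \<bullet> E)"
    using assms has_derivative_unique unfolding gderiv_def by blast
  then have "(D - E) \<bullet> D = (D - E) \<bullet> E" by meson
  then have "(D - E) \<bullet> (D - E) = 0" by (simp add: inner_diff_right)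
  then show ?thesis by simp
qed

lemma GDERIV_grad:
  fixes f :: "'a::euclidean_space \<Rightarrow> real"
  assumes "f differentiable (at x)"
  shows "GDERIV f x :> grad f x"
proof -
  obtain f' where f': "(f has_derivative f') (at x)"
    using assms unfolding differentiable_def by blast
  then have "linear f'" by (rule has_derivative_linear)
  then have "f' = (\<lambda>h. h \<bullet> adjoint f' 1)"
    using adjoint_works[of f' _ 1] by fastforce
  with f' have "GDERIV f x :> adjoint f' 1" unfolding gderiv_def by simp
  then show ?thesis
    unfolding grad_def using GDERIV_unique by (metis theI')
qed

lemma GDERIV_difference_quotient:
  fixes f :: "'a::real_inner \<Rightarrow> real"
  assumes "GDERIV f w :> c"
  shows "((\<lambda>t. (f (w + t *\<^sub>R h) - f w) / t) \<longlongrightarrow> c \<bullet> h) (at_right 0)"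
proof -
  have outer: "(f has_derivative (\<lambda>h. h \<bullet> c)) (at (w + 0 *\<^sub>R h))"
    using assms unfolding gderiv_def by simp
  have inner: "((\<lambda>t. w + t *\<^sub>R h) has_derivative (\<lambda>t. t *\<^sub>R h)) (at (0::real))"
    by (auto intro!: derivative_eq_intros)
  have "((\<lambda>t. f (w + t *\<^sub>R h)) has_derivative (\<lambda>t. (t *\<^sub>R h) \<bullet> c)) (at 0)"
    using has_derivative_compose[OF inner outer] .
  then have "((\<lambda>t. f (w + t *\<^sub>R h)) has_field_derivative c \<bullet> h) (at 0)"
    unfolding has_field_derivative_def
    by (rule has_derivative_eq_rhs) (auto simp: inner_commute mult.commute)
  then have "((\<lambda>t. (f (w + t *\<^sub>R h) - f w) / t) \<longlongrightarrow> c \<bullet> h) (at 0)"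
    unfolding DERIV_def by simp
  then show ?thesis by (rule tendsto_within_subset) simp
qed

text \<open>
  The difference quotients along the segment from \<open>w\<close> to \<open>v\<close> tend to \<open>c \<bullet> (v - w)\<close>. They are
  nonnegative if \<open>w\<close> is a minimum, and by convexity they never exceed \<open>f v - f w\<close>; the first
  bound gives one direction, the second the other.
\<close>

lemma minimum_iff_variational_inequality:
  fixes f :: "'a::real_inner \<Rightarrow> real"
  assumes conv: "convex_on U f" and K: "convex K" "K \<subseteq> U" and w: "w \<in> K"
    and c: "GDERIV f w :> c"
  shows "(\<forall>v\<in>K. f w \<le> f v) \<longleftrightarrow> (\<forall>v\<in>K. 0 \<le> c \<bullet> (v - w))"
proof -
  define q where "q v t = (f (w + t *\<^sub>R (v - w)) - f w) / t" for v and t :: real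
  have lim: "(q v \<longlongrightarrow> c \<bullet> (v - w)) (at_right 0)" for v
    unfolding q_def by (rule GDERIV_difference_quotient[OF c])
  have ev: "\<forall>\<^sub>F t in at_right 0. t \<in> {0<..<1::real}"
    by (rule eventually_at_right_real) simp
  have point: "w + t *\<^sub>R (v - w) = (1 - t) *\<^sub>R w + t *\<^sub>R v" for v and t :: real
    by (simp add: algebra_simps)
  show ?thesis
  proof (intro iffI ballI)
    fix v assume min: "\<forall>v\<in>K. f w \<le> f v" and v: "v \<in> K"
    have "0 \<le> q v t" if "t \<in> {0<..<1}" for t
      using that min w v convexD_alt[OF K(1) w v, of t] by (simp add: q_def point)
    then have "\<forall>\<^sub>F t in at_right 0. 0 \<le> q v t"
      using ev by (auto elim: eventually_mono)
    then show "0 \<le> c \<bullet> (v - w)"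
      by (intro tendsto_lowerbound[OF lim]) auto
  next
    fix v assume vi: "\<forall>v\<in>K. 0 \<le> c \<bullet> (v - w)" and v: "v \<in> K"
    have "q v t \<le> f v - f w" if t: "t \<in> {0<..<1}" for t
    proof -
      have "f ((1 - t) *\<^sub>R w + t *\<^sub>R v) \<le> (1 - t) * f w + t * f v"
        using t v w K(2) by (intro convex_onD[OF conv]) auto
      then show ?thesis using t by (simp add: q_def point divide_simps algebra_simps)
    qed
    then have "\<forall>\<^sub>F t in at_right 0. q v t \<le> f v - f w"
      using ev by (auto elim: eventually_mono)
    then have "c \<bullet> (v - w) \<le> f v - f w"
      by (intro tendsto_upperbound[OF lim]) auto
    then show "f w \<le> f v" using vi v by force
  qed
qed

section \<open>The polytope and its linear program\<close>

lemma feasible_subset_cbox: "feasible m0 \<subseteq> cbox 0 (1 :: real ^ 'm)"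
  by (auto simp: feasible_def mem_box_cart)

lemma convex_feasible: "convex (feasible m0 :: (real ^ 'm) set)"
proof (rule convexI)
  fix x y :: "real ^ 'm" and a b :: real
  assume x: "x \<in> feasible m0" and y: "y \<in> feasible m0" and ab: "0 \<le> a" "0 \<le> b" "a + b = 1"
  have "a *\<^sub>R x + b *\<^sub>R y \<in> cbox 0 1"
    using x y ab feasible_subset_cbox by (intro convexD[OF convex_box(1)]) auto
  moreover have "(\<Sum>k\<in>UNIV. (a *\<^sub>R x + b *\<^sub>R y) $ k) =
      a * (\<Sum>k\<in>UNIV. x $ k) + b * (\<Sum>k\<in>UNIV. y $ k)"
    by (simp add: sum.distrib sum_distrib_left)
  moreover have "\<dots> \<le> real m0"
    using x y ab unfolding feasible_def by (intro convex_bound_le) auto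
  ultimately show "a *\<^sub>R x + b *\<^sub>R y \<in> feasible m0"
    by (auto simp: feasible_def mem_box_cart)
qed

text \<open>
  The polytope lies in the half-space cut out by the budget constraint, whose interior consists of
  the points with strict inequality.
\<close>

lemma budget_exhausted_in_frontier:
  fixes w :: "real ^ 'm"
  assumes w: "w \<in> feasible m0" and total: "(\<Sum>k\<in>UNIV. w $ k) = real m0"
  shows "w \<in> frontier (feasible m0)"
proof -
  have ones: "(1 :: real ^ 'm) \<bullet> v = (\<Sum>k\<in>UNIV. v $ k)" for v
    by (simp add: inner_vec_def)
  have "feasible m0 \<subseteq> {v :: real ^ 'm. 1 \<bullet> v \<le> real m0}"
    by (auto simp: feasible_def ones)
  from interior_mono[OF this]
  have "interior (feasible m0) \<subseteq> {v :: real ^ 'm. 1 \<bullet> v < real m0}"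
    by simp
  with total have "w \<notin> interior (feasible m0)" by (auto simp: ones)
  with w show ?thesis using closure_subset unfolding frontier_def by blast
qed

text \<open>
  Complementary slackness for the linear program, with \<open>\<theta>\<close> as the multiplier of the budget and
  \<open>c\<^sub>k - \<theta>\<close> as the reduced costs.
\<close>

definition threshold_vector :: "real ^ 'm \<Rightarrow> real \<Rightarrow> nat \<Rightarrow> real ^ 'm \<Rightarrow> bool" where
  "threshold_vector c \<theta> m0 w \<longleftrightarrow>
     (\<forall>k. c $ k < \<theta> \<longrightarrow> w $ k = 1) \<and> (\<forall>k. \<theta> < c $ k \<longrightarrow> w $ k = 0) \<and>
     (\<Sum>k\<in>UNIV. w $ k) = real m0"

text \<open>
  Optimality is tested against a single competitor, the indicator of \<open>S\<close>; complementary slackness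
  then follows because a nonnegative sum of nonpositive terms vanishes term by term.
\<close>

lemma linear_program_optimal_iff:
  fixes c w :: "real ^ 'm"
  assumes w: "w \<in> feasible m0" and neg: "\<theta> < 0" and S: "card S = m0"
    and below: "\<And>k. k \<in> S \<Longrightarrow> c $ k \<le> \<theta>" and above: "\<And>k. k \<notin> S \<Longrightarrow> \<theta> \<le> c $ k"
  shows "(\<forall>v \<in> feasible m0. 0 \<le> c \<bullet> (v - w)) \<longleftrightarrow> threshold_vector c \<theta> m0 w"
proof -
  have split: "c \<bullet> (v - w) = (\<Sum>k\<in>UNIV. (c $ k - \<theta>) * (v $ k - w $ k))
      + \<theta> * ((\<Sum>k\<in>UNIV. v $ k) - (\<Sum>k\<in>UNIV. w $ k))" for v
    by (simp add: inner_vec_def sum.distrib[symmetric] sum_subtractf[symmetric]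
        sum_distrib_left algebra_simps)
  show ?thesis
  proof
    assume opt: "\<forall>v \<in> feasible m0. 0 \<le> c \<bullet> (v - w)"
    \<comment> \<open>a vertex of the polytope that spends the whole budget on the smallest entries\<close>
    define v :: "real ^ 'm" where "v = (\<chi> k. if k \<in> S then 1 else 0)"
    have v_sum: "(\<Sum>k\<in>UNIV. v $ k) = real m0"
      using S by (simp add: v_def sum.If_cases)
    then have v: "v \<in> feasible m0" by (auto simp: feasible_def v_def)
    have w_bounds: "0 \<le> w $ k" "w $ k \<le> 1" for k using w by (auto simp: feasible_def)
    have terms: "(c $ k - \<theta>) * (v $ k - w $ k) \<le> 0" for k
      using below[of k] above[of k] w_bounds[of k]
      by (cases "k \<in> S") (auto simp: v_def intro: mult_nonpos_nonneg)
    have budget: "\<theta> * (real m0 - (\<Sum>k\<in>UNIV. w $ k)) \<le> 0"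
      using w neg by (intro mult_nonpos_nonneg) (auto simp: feasible_def)
    have "(\<Sum>k\<in>UNIV. (c $ k - \<theta>) * (v $ k - w $ k)) \<le> 0"
      by (intro sum_nonpos terms)
    with budget opt v v_sum split[of v]
    have zero: "(\<Sum>k\<in>UNIV. (c $ k - \<theta>) * (v $ k - w $ k)) = 0"
      and "\<theta> * (real m0 - (\<Sum>k\<in>UNIV. w $ k)) = 0"
      by (smt (verit))+
    then have total: "(\<Sum>k\<in>UNIV. w $ k) = real m0" using neg by simp
    have "(c $ k - \<theta>) * (v $ k - w $ k) = 0" for k
      using zero terms sum_nonneg_eq_0_iff[of UNIV "\<lambda>k. - ((c $ k - \<theta>) * (v $ k - w $ k))"]
      by (simp add: sum_negf)
    then have slack: "c $ k = \<theta> \<or> v $ k = w $ k" for k by (metis eq_iff_diff_eq_0 mult_eq_0_iff)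
    have "w $ k = 1" if "c $ k < \<theta>" for k
      using that above[of k] slack[of k] by (force simp: v_def)
    moreover have "w $ k = 0" if "\<theta> < c $ k" for k
      using that below[of k] slack[of k] by (force simp: v_def)
    ultimately show "threshold_vector c \<theta> m0 w"
      using total by (simp add: threshold_vector_def)
  next
    assume thr: "threshold_vector c \<theta> m0 w"
    show "\<forall>v \<in> feasible m0. 0 \<le> c \<bullet> (v - w)"
    proof
      fix v :: "real ^ 'm" assume v: "v \<in> feasible m0"
      have "0 \<le> (c $ k - \<theta>) * (v $ k - w $ k)" for k
      proof (cases "c $ k" \<theta> rule: linorder_cases)
        case less
        then show ?thesis using thr v
          by (auto simp: threshold_vector_def feasible_def intro: mult_nonpos_nonpos)
      next
        case greater
        then show ?thesis using thr v by (auto simp: threshold_vector_def feasible_def)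
      qed simp
      then have "0 \<le> (\<Sum>k\<in>UNIV. (c $ k - \<theta>) * (v $ k - w $ k))" by (intro sum_nonneg)
      moreover have "0 \<le> \<theta> * ((\<Sum>k\<in>UNIV. v $ k) - (\<Sum>k\<in>UNIV. w $ k))"
        using thr v neg by (intro mult_nonpos_nonpos) (auto simp: threshold_vector_def feasible_def)
      ultimately show "0 \<le> c \<bullet> (v - w)" by (simp add: split)
    qed
  qed
qed

text \<open>
  The set \<open>S\<close> stands for the first \<open>m\<^sub>0\<close> indices of a sorted enumeration: all that matters about
  sorting is that \<open>\<theta>\<close> separates \<open>m\<^sub>0\<close> entries of the gradient from the others.
\<close>

lemma minimum_iff_threshold:
  fixes J :: "real ^ 'm \<Rightarrow> ereal"
  assumes J: "finite_convex_C1_near J (cbox 0 1)" and w: "w \<in> feasible m0"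
    and neg: "\<theta> < 0" and S: "card S = m0"
    and below: "\<And>k. k \<in> S \<Longrightarrow> egrad J w $ k \<le> \<theta>"
    and above: "\<And>k. k \<notin> S \<Longrightarrow> \<theta> \<le> egrad J w $ k"
  shows "is_arg_min J (\<lambda>v. v \<in> feasible m0) w \<longleftrightarrow> threshold_vector (egrad J w) \<theta> m0 w"
proof -
  define f where "f = (\<lambda>v. real_of_ereal (J v))"
  obtain U where U: "cbox 0 1 \<subseteq> U" "\<And>v. v \<in> U \<Longrightarrow> \<bar>J v\<bar> \<noteq> \<infinity>" "convex_on U f"
      "cont_diff_on f U"
    using J unfolding finite_convex_C1_near_def f_def[symmetric] by auto
  have sub: "feasible m0 \<subseteq> U" using U(1) feasible_subset_cbox by blast
  have J_eq: "J v = ereal (f v)" if "v \<in> feasible m0" for v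
    using U(2)[of v] sub that by (auto simp: f_def ereal_real)
  have "GDERIV f w :> egrad J w"
    using U(4) sub w GDERIV_grad[of f w]
    by (auto simp: cont_diff_on_def egrad_def f_def)
  note minimum_iff_variational_inequality[OF U(3) convex_feasible sub w this]
  also have "(\<forall>v\<in>feasible m0. 0 \<le> egrad J w \<bullet> (v - w)) \<longleftrightarrow>
      threshold_vector (egrad J w) \<theta> m0 w"
    by (rule linear_program_optimal_iff[OF w neg S]) (fact below above)+
  finally have "(\<forall>v\<in>feasible m0. f w \<le> f v) \<longleftrightarrow> threshold_vector (egrad J w) \<theta> m0 w" .
  moreover have "is_arg_min J (\<lambda>v. v \<in> feasible m0) w \<longleftrightarrow> (\<forall>v\<in>feasible m0. f w \<le> f v)"
    using w by (auto simp: is_arg_min_def J_eq not_less)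
  ultimately show ?thesis by simp
qed

section \<open>Reading the threshold off a sorted enumeration\<close>

text \<open>
  The conventional values \<open>0\<close> and \<open>m + 1\<close> lie just outside the index range, so that comparison with
  the two indices expresses a strict inequality between values also when no index satisfies it.
\<close>

lemma le_lower_index_iff:
  assumes sorted: "\<And>i j. 1 \<le> i \<Longrightarrow> i \<le> j \<Longrightarrow> j \<le> m \<Longrightarrow> g i \<le> g j" and k: "k \<in> {1..m}"
  shows "k \<le> lower_index m g m0 \<longleftrightarrow> g k < g m0"
proof -
  define S where "S = {k \<in> {1..m}. g k < g m0}"
  have fin: "finite S" by (simp add: S_def)
  have li: "lower_index m g m0 = (if S = {} then 0 else Max S)"
    unfolding lower_index_def S_def Let_def ..
  show ?thesis
  proof
    assume le: "k \<le> lower_index m g m0"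
    with k li have ne: "S \<noteq> {}" by auto
    with le li have "k \<le> Max S" by simp
    moreover have "Max S \<in> S" using Max_in fin ne by blast
    ultimately show "g k < g m0" using sorted[of k "Max S"] k unfolding S_def by force
  next
    assume "g k < g m0"
    with k have "k \<in> S" by (simp add: S_def)
    then show "k \<le> lower_index m g m0" using li fin Max_ge by auto
  qed
qed

lemma upper_index_le_iff:
  assumes sorted: "\<And>i j. 1 \<le> i \<Longrightarrow> i \<le> j \<Longrightarrow> j \<le> m \<Longrightarrow> g i \<le> g j" and k: "k \<in> {1..m}"
  shows "upper_index m g m0 \<le> k \<longleftrightarrow> g m0 < g k"
proof -
  define S where "S = {k \<in> {1..m}. g m0 < g k}"
  have fin: "finite S" by (simp add: S_def)
  have ui: "upper_index m g m0 = (if S = {} then m + 1 else Min S)"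
    unfolding upper_index_def S_def Let_def ..
  show ?thesis
  proof
    assume le: "upper_index m g m0 \<le> k"
    with k ui have ne: "S \<noteq> {}" by auto
    with le ui have "Min S \<le> k" by simp
    moreover have "Min S \<in> S" using Min_in fin ne by blast
    ultimately show "g m0 < g k" using sorted[of "Min S" k] k unfolding S_def by force
  next
    assume "g m0 < g k"
    with k have "k \<in> S" by (simp add: S_def)
    then show "upper_index m g m0 \<le> k" using ui fin Min_le by auto
  qed
qed

text \<open>
  With a gap after position \<open>m\<^sub>0\<close>, the budget leaves no freedom: \<open>m\<^sub>0\<close> coordinates of size at most
  \<open>1\<close> have to add up to \<open>m\<^sub>0\<close>.
\<close>

lemma threshold_at_gap_iff:
  fixes g u :: "nat \<Rightarrow> real"
  assumes m0: "1 \<le> m0" "m0 < m"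
    and sorted: "\<And>i j. 1 \<le> i \<Longrightarrow> i \<le> j \<Longrightarrow> j \<le> m \<Longrightarrow> g i \<le> g j"
    and gap: "g m0 < g (m0 + 1)" and u: "\<And>k. u k \<le> 1"
  shows "(\<forall>k\<in>{1..m}. g k < g m0 \<longrightarrow> u k = 1) \<and> (\<forall>k\<in>{1..m}. g m0 < g k \<longrightarrow> u k = 0) \<and>
      sum u {1..m} = real m0 \<longleftrightarrow>
    (\<forall>k\<in>{1..m}. k \<le> m0 \<longrightarrow> u k = 1) \<and> (\<forall>k\<in>{1..m}. m0 < k \<longrightarrow> u k = 0)"
    (is "?thr \<longleftrightarrow> ?ones \<and> ?zeros")
proof -
  have le: "g k \<le> g m0" if "k \<in> {1..m}" "k \<le> m0" for k
    using that m0 sorted[of k m0] by simp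
  have gt: "g m0 < g k" if "k \<in> {1..m}" "m0 < k" for k
    using that gap sorted[of "m0 + 1" k] by simp
  have first: "sum u {1..m} = sum u {1..m0}" if ?zeros
    using m0 that by (intro sum.mono_neutral_right) auto
  show ?thesis
  proof
    assume thr: ?thr
    then have z: ?zeros using gt by blast
    then have "sum u {1..m0} = real m0" using thr first by simp
    then have "(\<Sum>k\<in>{1..m0}. 1 - u k) = 0" by (simp add: sum_subtractf)
    then have "\<forall>k\<in>{1..m0}. 1 - u k = 0" using u by (subst (asm) sum_nonneg_eq_0_iff) auto
    then have ?ones by auto
    with z show "?ones \<and> ?zeros" by blast
  next
    assume oz: "?ones \<and> ?zeros"
    have "sum u {1..m0} = (\<Sum>k\<in>{1..m0}. 1)" using oz m0 by (intro sum.cong) auto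
    then have "sum u {1..m} = real m0" using oz first by simp
    moreover have "u k = 1" if "k \<in> {1..m}" "g k < g m0" for k
      using oz gt[of k] that by (meson not_less order_less_asym)
    moreover have "u k = 0" if "k \<in> {1..m}" "g m0 < g k" for k
      using oz le[of k] that by (meson not_less)
    ultimately show ?thr by blast
  qed
qed

lemma negative_at_rank:
  fixes g :: "nat \<Rightarrow> real"
  assumes m0: "1 \<le> m0" "m0 \<le> m"
    and sorted: "\<And>i j. 1 \<le> i \<Longrightarrow> i \<le> j \<Longrightarrow> j \<le> m \<Longrightarrow> g i \<le> g j"
    and card: "m0 \<le> card {k \<in> {1..m}. g k < 0}"
  shows "g m0 < 0"
proof (rule ccontr)
  assume nonneg: "\<not> g m0 < 0"
  have "{k \<in> {1..m}. g k < 0} \<subseteq> {1..<m0}"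
  proof safe
    fix k assume k: "k \<in> {1..m}" "g k < 0"
    with nonneg sorted[of m0 k] m0 show "k \<in> {1..<m0}" by force
  qed
  then have "card {k \<in> {1..m}. g k < 0} \<le> card {1..<m0}" by (intro card_mono) auto
  with card m0 show False by simp
qed

theorem theorem3:
  fixes J :: "real ^ 'm \<Rightarrow> ereal"
    and m m0 :: nat
    and w :: "real ^ 'm"
    and \<sigma> :: "nat \<Rightarrow> 'm"
    and g :: "nat \<Rightarrow> real"
  assumes m: "m = CARD('m)"
    and m0: "1 \<le> m0" "m0 < m"
    and J_range: "\<And>v. J v \<noteq> - \<infinity>"
    and J_near_cube: "finite_convex_C1_near J (cbox 0 1)"
    and neg_grad: "m0 \<le> card {k. \<forall>v \<in> feasible m0. egrad J v $ k < 0}"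
    and w: "w \<in> feasible m0"
    and reorder: "bij_betw \<sigma> {1..m} UNIV"
    and g: "\<And>k. g k = egrad J w $ \<sigma> k"
    and sorted: "\<And>i j. 1 \<le> i \<Longrightarrow> i \<le> j \<Longrightarrow> j \<le> m \<Longrightarrow> g i \<le> g j"
  shows
    "(g m0 < g (m0 + 1) \<longrightarrow>
        (is_arg_min J (\<lambda>v. v \<in> feasible m0) w \<longleftrightarrow>
           (\<forall>k\<in>{1..m}. k \<le> m0 \<longrightarrow> w $ \<sigma> k = 1) \<and>
           (\<forall>k\<in>{1..m}. m0 < k \<longrightarrow> w $ \<sigma> k = 0)))
     \<and>
     (g m0 = g (m0 + 1) \<longrightarrow>
        (is_arg_min J (\<lambda>v. v \<in> feasible m0) w \<longleftrightarrow>
           (\<forall>k\<in>{1..m}. k \<le> lower_index m g m0 \<longrightarrow> w $ \<sigma> k = 1) \<and>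
           (\<forall>k\<in>{1..m}. upper_index m g m0 \<le> k \<longrightarrow> w $ \<sigma> k = 0) \<and>
           (\<Sum>k\<in>{1..m}. w $ \<sigma> k) = real m0)
        \<and> ((\<Sum>k\<in>{1..m}. w $ \<sigma> k) = real m0 \<longrightarrow> w \<in> frontier (feasible m0)))"
proof -
  have inj: "inj_on \<sigma> {1..m}" and surj: "\<sigma> ` {1..m} = UNIV"
    using reorder by (auto simp: bij_betw_def)
  have all_\<sigma>: "(\<forall>k. P k) \<longleftrightarrow> (\<forall>i\<in>{1..m}. P (\<sigma> i))" for P
    using surj by (metis UNIV_I imageE)
  have total: "(\<Sum>k\<in>UNIV. w $ k) = (\<Sum>k\<in>{1..m}. w $ \<sigma> k)"
    using sum.reindex_bij_betw[OF reorder] by metis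
  have "{k. \<forall>v \<in> feasible m0. egrad J v $ k < 0} \<subseteq> \<sigma> ` {k \<in> {1..m}. g k < 0}"
  proof
    fix k assume "k \<in> {k. \<forall>v \<in> feasible m0. egrad J v $ k < 0}"
    then have "egrad J w $ k < 0" using w by blast
    moreover obtain i where "i \<in> {1..m}" "k = \<sigma> i" using surj by (metis UNIV_I imageE)
    ultimately show "k \<in> \<sigma> ` {k \<in> {1..m}. g k < 0}" using g by auto
  qed
  then have "card {k. \<forall>v \<in> feasible m0. egrad J v $ k < 0} \<le> card {k \<in> {1..m}. g k < 0}"
    by (intro surj_card_le) auto
  with neg_grad have neg: "g m0 < 0"
    using m0 sorted by (intro negative_at_rank[of m0 m g]) auto
  define S where "S = \<sigma> ` {1..m0}"
  have card_S: "card S = m0"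
    unfolding S_def using m0 by (subst card_image) (auto intro: inj_on_subset[OF inj])
  have below: "egrad J w $ k \<le> g m0" if "k \<in> S" for k
    using that g sorted m0 unfolding S_def by fastforce
  have above: "g m0 \<le> egrad J w $ k" if k: "k \<notin> S" for k
  proof -
    obtain i where i: "i \<in> {1..m}" "k = \<sigma> i" using surj by (metis UNIV_I imageE)
    with k have "m0 < i" unfolding S_def by force
    with i show ?thesis using g sorted[of m0 i] m0 by simp
  qed
  have "is_arg_min J (\<lambda>v. v \<in> feasible m0) w \<longleftrightarrow> threshold_vector (egrad J w) (g m0) m0 w"
    by (rule minimum_iff_threshold[OF J_near_cube w neg card_S]) (fact below above)+
  then have min_iff: "is_arg_min J (\<lambda>v. v \<in> feasible m0) w \<longleftrightarrow>
      (\<forall>k\<in>{1..m}. g k < g m0 \<longrightarrow> w $ \<sigma> k = 1) \<and> (\<forall>k\<in>{1..m}. g m0 < g k \<longrightarrow> w $ \<sigma> k = 0) \<and>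
      (\<Sum>k\<in>{1..m}. w $ \<sigma> k) = real m0"
    unfolding threshold_vector_def total all_\<sigma> g .
  have w_le: "w $ \<sigma> k \<le> 1" for k using w by (simp add: feasible_def)
  have gap_case: "is_arg_min J (\<lambda>v. v \<in> feasible m0) w \<longleftrightarrow>
      (\<forall>k\<in>{1..m}. k \<le> m0 \<longrightarrow> w $ \<sigma> k = 1) \<and> (\<forall>k\<in>{1..m}. m0 < k \<longrightarrow> w $ \<sigma> k = 0)"
    if "g m0 < g (m0 + 1)"
    unfolding min_iff 
    by (rule threshold_at_gap_iff[OF m0 _ that w_le]) (fact sorted)
  have tie_case: "is_arg_min J (\<lambda>v. v \<in> feasible m0) w \<longleftrightarrow>
      (\<forall>k\<in>{1..m}. k \<le> lower_index m g m0 \<longrightarrow> w $ \<sigma> k = 1) \<and>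
      (\<forall>k\<in>{1..m}. upper_index m g m0 \<le> k \<longrightarrow> w $ \<sigma> k = 0) \<and>
      (\<Sum>k\<in>{1..m}. w $ \<sigma> k) = real m0"
  proof -
    have "k \<le> lower_index m g m0 \<longleftrightarrow> g k < g m0" if "k \<in> {1..m}" for k
      by (rule le_lower_index_iff[OF _ that]) (fact sorted)
    moreover have "upper_index m g m0 \<le> k \<longleftrightarrow> g m0 < g k" if "k \<in> {1..m}" for k
      by (rule upper_index_le_iff[OF _ that]) (fact sorted)
    ultimately show ?thesis using min_iff by simp
  qed
  have "(\<Sum>k\<in>{1..m}. w $ \<sigma> k) = real m0 \<Longrightarrow> w \<in> frontier (feasible m0)"
    using budget_exhausted_in_frontier[OF w] total by simp
  with gap_case tie_case show ?thesis by blast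
qed

end
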